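(* Let $n\ge 3$ be an integer. For any $a,r\in\mathbb{R}$, the matrix $\mathrm{Circ}(ar^{n-1},\ldots,ar,a)\in\mathcal{M}_n(\mathbb{R})$ is invertible if and only if $a(r^n-1)\neq 0$. In this case, the inverse matrix is $$\mathrm{Circ}(ar^{n-1},\ldots,ar,a)^{-1}=\big(a(r^n-1)\big)^{-1}\,\mathrm{Circ}(r,-1,0,\ldots,0).$$
   Context: For $(a_1,\ldots,a_n)\in\mathbb{R}^n$, $\mathrm{Circ}(a_1,\ldots,a_n)\in\mathcal{M}_n(\mathbb{R})$ denotes the circulant matrix whose $(i,j)$ entry is $a_{1+((j-i)\bmod n)}$; its first row is $(a_1,\ldots,a_n)$ and each row is the cyclic right shift of the previous one. In $\mathrm{Circ}(r,-1,0,\ldots,0)$ there are $n-2$ zeros. *)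

theory Defs
  imports Complex_Main "Jordan_Normal_Form.Matrix"
begin

(* The list is the first row.  Indices of matrices and lists start at 0 here, so entry (i, j) is
   the list element at index (j - i) mod n.  The subtraction is done on the integers because on the
   naturals it truncates when j < i. *)
definition circ :: "'a list \<Rightarrow> 'a mat" where
  "circ as = mat (length as) (length as)
     (\<lambda>(i, j). as ! nat ((int j - int i) mod int (length as)))"

end

theory Submission
  imports Defs "Jordan_Normal_Form.Determinant"
begin

text \<open>
  Let \<open>C\<close> be the circulant matrix with first row \<open>r, -1, 0, \<dots>, 0\<close> and \<open>A\<close> the one with first row
  \<open>a r\<^sup>n\<^sup>-\<^sup>1, \<dots>, a r, a\<close>.  Multiplying by \<open>C\<close> from the left replaces row \<open>i\<close> of \<open>A\<close> by
  \<open>r\<close> times row \<open>i\<close> minus the cyclically next row.  The entries of \<open>A\<close> form a geometric progression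
  along the cyclic offset \<open>j - i\<close>, so these two terms cancel, except on the diagonal: there
  the progression wraps around and \<open>r \<cdot> a r\<^sup>n\<^sup>-\<^sup>1 - a\<close> remains.  Hence \<open>C A = a (r\<^sup>n - 1) I\<close>
  (\<open>circ_difference_mult_circ_geometric\<close>).

  If the scalar \<open>a (r\<^sup>n - 1)\<close> is nonzero, dividing by it gives a left inverse of \<open>A\<close>, which for
  square matrices over a field is also a right inverse.  If it is zero, then \<open>C A = 0\<close> with
  \<open>C \<noteq> 0\<close>, and \<open>A\<close> cannot be invertible.
\<close>

lemma circ_carrier: "length as = n \<Longrightarrow> circ as \<in> carrier_mat n n"
  by (auto simp: circ_def)

lemma nat_diff_mod:
  assumes "i < n" "j < n"
  shows "nat ((int j - int i) mod int n) = (if i \<le> j then j - i else n + j - i)"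
proof (cases "i \<le> j")
  case True
  then have "(int j - int i) mod int n = int j - int i"
    using assms by (intro mod_pos_pos_trivial) auto
  then show ?thesis
    using True by simp
next
  case False
  have "(int j - int i) mod int n = (int j - int i + int n) mod int n"
    by simp
  also have "\<dots> = int j - int i + int n"
    using assms False by (intro mod_pos_pos_trivial) auto
  finally show ?thesis
    using False by simp
qed

lemma circ_index:
  assumes "length as = n" "i < n" "j < n"
  shows "circ as $$ (i, j) = as ! (if i \<le> j then j - i else n + j - i)"
  using assms by (simp add: circ_def nat_diff_mod)

text \<open>
  The nonzero entries sit at the cyclic offsets \<open>0\<close> and \<open>1\<close>, which are distinct only from
  \<open>n = 2\<close> on.
\<close>

lemma circ_difference_index:
  fixes r :: "'a :: comm_ring_1"
  assumes "n \<ge> 2" "i < n" "j < n"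
  shows "circ ([r, - 1] @ replicate (n - 2) 0) $$ (i, j) =
    (if j = i then r else if j = Suc i mod n then - 1 else 0)"
proof -
  define d where "d = (if i \<le> j then j - i else n + j - i)"
  have len: "length ([r, - 1] @ replicate (n - 2) 0) = n"
    using assms by simp
  have "d < n" and d0: "d = 0 \<longleftrightarrow> j = i"
    using assms by (auto simp: d_def)
  have d1: "d = 1 \<longleftrightarrow> j = Suc i mod n"
    using assms by (cases "Suc i = n") (auto simp: d_def)
  have "([r, - 1] @ replicate (n - 2) 0) ! d = (if d = 0 then r else if d = 1 then - 1 else 0)"
    using \<open>d < n\<close> by (auto simp: nth_Cons split: nat.split)
  then show ?thesis
    using circ_index[OF len assms(2,3)] d0 d1 by (simp add: d_def)
qed

lemma circ_geometric_index:
  fixes a r :: "'a :: comm_ring_1"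
  assumes "i < n" "j < n"
  shows "circ (map (\<lambda>k. a * r ^ (n - 1 - k)) [0..<n]) $$ (i, j) =
    a * r ^ (if i \<le> j then n - 1 - (j - i) else i - j - 1)"
proof -
  have "n - 1 - (n + j - i) = i - j - 1" if "\<not> i \<le> j"
    using assms that by simp
  then show ?thesis
    using assms by (auto simp: circ_index)
qed

text \<open>
  Row \<open>i\<close> of the left factor is supported on the columns \<open>i\<close> and \<open>i + 1\<close> (cyclically), so each
  entry of the product is a difference of two consecutive entries in a column of the right
  factor, the first one scaled by the ratio \<open>r\<close> of the progression.
\<close>

lemma circ_difference_mult_circ_geometric:
  fixes a r :: "'a :: comm_ring_1"
  assumes "n \<ge> 2"
  shows "circ ([r, - 1] @ replicate (n - 2) 0) * circ (map (\<lambda>k. a * r ^ (n - 1 - k)) [0..<n])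
    = (a * (r ^ n - 1)) \<cdot>\<^sub>m 1\<^sub>m n"
    (is "?C * ?A = _")
proof (rule eq_matI)
  have C: "?C \<in> carrier_mat n n"
    using assms by (intro circ_carrier) simp
  have A: "?A \<in> carrier_mat n n"
    by (intro circ_carrier) simp
  show "dim_row (?C * ?A) = dim_row ((a * (r ^ n - 1)) \<cdot>\<^sub>m 1\<^sub>m n)"
    and "dim_col (?C * ?A) = dim_col ((a * (r ^ n - 1)) \<cdot>\<^sub>m 1\<^sub>m n)"
    using C A by auto
  fix i j
  assume "i < dim_row ((a * (r ^ n - 1)) \<cdot>\<^sub>m 1\<^sub>m n)" "j < dim_col ((a * (r ^ n - 1)) \<cdot>\<^sub>m 1\<^sub>m n)"
  then have i: "i < n" and j: "j < n"
    by auto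
  define i' where "i' = Suc i mod n"
  have i': "i' < n" "i' \<noteq> i"
    using assms i by (cases "Suc i = n"; simp add: i'_def)+
  have "(?C * ?A) $$ (i, j) = (\<Sum>k<n. ?C $$ (i, k) * ?A $$ (k, j))"
    using C A i j by (simp add: scalar_prod_def atLeast0LessThan)
  also have "\<dots> = (\<Sum>k<n. (if k = i then r else if k = i' then - 1 else 0) * ?A $$ (k, j))"
    unfolding i'_def using assms i by (intro sum.cong refl) (simp only: circ_difference_index lessThan_iff)
  also have "\<dots> = (\<Sum>k\<in>{i, i'}. (if k = i then r else if k = i' then - 1 else 0) * ?A $$ (k, j))"
    using i i' by (intro sum.mono_neutral_right) auto
  also have "\<dots> = r * ?A $$ (i, j) - ?A $$ (i', j)"
    using i' by simp
  also have "\<dots> = (if i = j then a * (r ^ n - 1) else 0)"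
  proof (cases "i = j")
    case True
    \<comment> \<open>The row after the last one is row \<open>0\<close>; in either case the offset jumps from \<open>0\<close> to \<open>n - 1\<close>.\<close>
    have "?A $$ (i', j) = a"
      unfolding circ_geometric_index[OF i'(1) j]
      using True i by (cases "Suc i = n") (auto simp: i'_def)
    moreover have "r * ?A $$ (i, j) = a * r ^ n"
      unfolding circ_geometric_index[OF i j]
      using True i by (cases n) (simp_all add: algebra_simps)
    ultimately show ?thesis
      using True by (simp add: algebra_simps)
  next
    case False
    have step: "r * (a * r ^ p) = a * r ^ q" if "q = Suc p" for p q
      using that by simp
    have "r * ?A $$ (i, j) = ?A $$ (i', j)"
      unfolding circ_geometric_index[OF i j] circ_geometric_index[OF i'(1) j]
      using False i j by (intro step) (cases "Suc i = n"; auto simp: i'_def)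
    then show ?thesis
      using False by simp
  qed
  also have "\<dots> = ((a * (r ^ n - 1)) \<cdot>\<^sub>m 1\<^sub>m n) $$ (i, j)"
    using i j by simp
  finally show "(?C * ?A) $$ (i, j) = ((a * (r ^ n - 1)) \<cdot>\<^sub>m 1\<^sub>m n) $$ (i, j)" .
qed

lemma invertible_mat_mult_left_eq_0:
  fixes A C :: "'a :: comm_ring_1 mat"
  assumes "A \<in> carrier_mat n n" "C \<in> carrier_mat n n"
    and "invertible_mat A" "C * A = 0\<^sub>m n n"
  shows "C = 0\<^sub>m n n"
proof -
  obtain B where AB: "A * B = 1\<^sub>m n" and BA: "B * A = 1\<^sub>m (dim_row B)"
    using assms(1,3) by (auto simp: invertible_mat_def inverts_mat_def)
  have "dim_col B = n"
    using arg_cong[OF AB, of dim_col] by simp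
  moreover have "dim_row B = n"
    using arg_cong[OF BA, of dim_col] assms(1) by simp
  ultimately have B: "B \<in> carrier_mat n n"
    by auto
  have "C = C * (A * B)"
    using assms(2) AB by simp
  also have "\<dots> = C * A * B"
    using assms(1,2) B by simp
  also have "\<dots> = 0\<^sub>m n n"
    using assms(4) B by simp
  finally show ?thesis .
qed

theorem corollary2p2:
  fixes n :: nat and a r :: real
  assumes "n \<ge> 3"
  shows "let A = circ (map (\<lambda>k. a * r ^ (n - 1 - k)) [0..<n]);
             B = inverse (a * (r ^ n - 1)) \<cdot>\<^sub>m circ ([r, - 1] @ replicate (n - 2) 0)
         in (invertible_mat A \<longleftrightarrow> a * (r ^ n - 1) \<noteq> 0) \<and>
            (invertible_mat A \<longrightarrow> inverts_mat A B \<and> inverts_mat B A)"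
proof -
  define A where "A = circ (map (\<lambda>k. a * r ^ (n - 1 - k)) [0..<n])"
  define C where "C = circ ([r, - 1] @ replicate (n - 2) 0)"
  define c where "c = a * (r ^ n - 1)"
  have A: "A \<in> carrier_mat n n"
    unfolding A_def by (intro circ_carrier) simp
  have C: "C \<in> carrier_mat n n"
    unfolding C_def using assms by (intro circ_carrier) simp
  have CA: "C * A = c \<cdot>\<^sub>m 1\<^sub>m n"
    using assms unfolding A_def C_def c_def by (intro circ_difference_mult_circ_geometric) simp
  have "C $$ (0, 1) = - 1"
    using assms circ_difference_index[of n 0 1 r] by (simp add: C_def)
  then have "C \<noteq> 0\<^sub>m n n"
    using assms by auto
  moreover have "C * A = 0\<^sub>m n n" if "c = 0"
    using that CA by (auto intro!: eq_matI)
  ultimately have nonzero: "c \<noteq> 0" if "invertible_mat A"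
    using invertible_mat_mult_left_eq_0[OF A C that] by blast
  have inverses: "inverts_mat A (inverse c \<cdot>\<^sub>m C) \<and> inverts_mat (inverse c \<cdot>\<^sub>m C) A" if "c \<noteq> 0"
  proof -
    have B: "inverse c \<cdot>\<^sub>m C \<in> carrier_mat n n"
      using C by simp
    have BA: "(inverse c \<cdot>\<^sub>m C) * A = 1\<^sub>m n"
      using that CA mult_smult_assoc_mat[OF C A] by (auto intro!: eq_matI)
    show ?thesis
      using BA mat_mult_left_right_inverse[OF B A BA] A C by (simp add: inverts_mat_def)
  qed
  then have "invertible_mat A" if "c \<noteq> 0"
    using that A unfolding invertible_mat_def by auto
  with nonzero inverses show ?thesis
    unfolding Let_def A_def[symmetric] C_def[symmetric] c_def[symmetric] by blast
qed

end
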